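(* Let $f\in S_{\mu,L}(\mathbb{R}^d)$ with minimizer $x^*$, and consider the noisy gradient descent iterations $x_{k+1}=x_k-\alpha(\nabla f(x_k)+w_k)$ with stepsize $\alpha>0$, where $\{w_k\}$ satisfies the noise assumption of the context. Assume there exist $\rho\in(0,1)$ and $p>0$ such that $$\begin{bmatrix} 2\mu L I_d & -(\mu+L)I_d \\ -(\mu+L)I_d & 2I_d \end{bmatrix}\succeq\Phi(A,B,P,\rho),\qquad A=I_d,\ B=-\alpha I_d,\ P=pI_d.$$ Then for all $k\ge0$, $$\mathbb{E}\left[\|x_k-x^*\|^2\right]\le\rho^{2k}\|x_0-x^*\|^2+\frac{1-\rho^{2k}}{1-\rho^2}\,\sigma^2\alpha^2d.$$
   Context: For $0<\mu\le L$, $S_{\mu,L}(\mathbb{R}^d)$ is the set of continuously differentiable $f:\mathbb{R}^d\to\mathbb{R}$ with $\frac L2\|x-y\|^2\ge f(x)-f(y)-\nabla f(y)^\top(x-y)\ge\frac\mu2\|x-y\|^2$ for all $x,y$. The matrix $\Phi$ is $\Phi(A,B,P,\rho)=\begin{bmatrix} A^\top PA-\rho^2P & A^\top PB \\ B^\top PA & B^\top PB \end{bmatrix}$, and $\succeq$ is the positive semidefinite order on symmetric matrices. Noise assumption: for some $\sigma>0$ and every $k\ge0$, the random vector $w_k\in\mathbb{R}^d$ has zero mean, is independent of $\{x_i\}_{i=1}^k$, and $\mathbb{E}[w_kw_k^\top]=\sigma^2I_d$; $x_0$ is deterministic. *)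

theory Defs
  imports "HOL-Analysis.Analysis" "HOL-Probability.Probability"
begin

definition grad :: "(real ^ 'n \<Rightarrow> real) \<Rightarrow> real ^ 'n \<Rightarrow> real ^ 'n" where
  "grad f x = (THE D. GDERIV f x :> D)"

lemma grad_eqI:
  fixes f :: "real ^ 'n \<Rightarrow> real"
  assumes "GDERIV f x :> D"
  shows "grad f x = D"
  unfolding grad_def
proof (rule the_equality)
  show "GDERIV f x :> D" by (fact assms)
next
  fix E assume "GDERIV f x :> E"
  then have "(f has_derivative (\<lambda>h. inner h E)) (at x)"
    by (simp only: gderiv_def)
  moreover have "(f has_derivative (\<lambda>h. inner h D)) (at x)"
    using assms by (simp only: gderiv_def)
  ultimately have "(\<lambda>h. inner h E) = (\<lambda>h. inner h D)"
    by (rule has_derivative_unique)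
  then have "\<forall>h. inner h E = inner h D"
    by (rule fun_eq_iff[THEN iffD1])
  then show "E = D"
    by (rule vector_eq_ldot[THEN iffD1])
qed

lemma GDERIV_grad:
  fixes f :: "real ^ 'n \<Rightarrow> real"
  assumes "f differentiable (at x)"
  shows "GDERIV f x :> grad f x"
proof -
  from assms obtain F where F: "(f has_derivative F) (at x)"
    unfolding differentiable_def by blast
  then interpret F: bounded_linear F
    by (rule has_derivative_bounded_linear)
  have "F = (\<lambda>h. inner h (adjoint F 1))"
    using adjoint_works[OF F.linear_axioms, of _ 1] by (simp add: fun_eq_iff)
  with F have "GDERIV f x :> adjoint F 1"
    unfolding gderiv_def by simp
  then show ?thesis
    by (simp only: grad_eqI)
qed

definition S_class :: "real \<Rightarrow> real \<Rightarrow> (real ^ 'n \<Rightarrow> real) set" where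
  "S_class \<mu> L = {f.
     (\<forall>x. f differentiable (at x)) \<and> continuous_on UNIV (grad f) \<and>
     (\<forall>x y. L / 2 * (norm (x - y))\<^sup>2 \<ge> f x - f y - grad f y \<bullet> (x - y) \<and>
            f x - f y - grad f y \<bullet> (x - y) \<ge> \<mu> / 2 * (norm (x - y))\<^sup>2)}"

definition block_matrix ::
  "real ^ 'n ^ 'p \<Rightarrow> real ^ 'm ^ 'p \<Rightarrow> real ^ 'n ^ 'q \<Rightarrow> real ^ 'm ^ 'q \<Rightarrow> real ^ ('n + 'm) ^ ('p + 'q)"
where
  "block_matrix M11 M12 M21 M22 = (\<chi> i j.
     case i of
       Inl a \<Rightarrow> (case j of Inl c \<Rightarrow> M11 $ a $ c | Inr d \<Rightarrow> M12 $ a $ d)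
     | Inr b \<Rightarrow> (case j of Inl c \<Rightarrow> M21 $ b $ c | Inr d \<Rightarrow> M22 $ b $ d))"

definition \<Phi> ::
  "real ^ 'n ^ 'n \<Rightarrow> real ^ 'm ^ 'n \<Rightarrow> real ^ 'n ^ 'n \<Rightarrow> real \<Rightarrow> real ^ ('n + 'm) ^ ('n + 'm)"
where
  "\<Phi> A B P \<rho> = block_matrix
     (transpose A ** P ** A - \<rho>\<^sup>2 *\<^sub>R P) (transpose A ** P ** B)
     (transpose B ** P ** A)              (transpose B ** P ** B)"

definition psd :: "real ^ 'n ^ 'n \<Rightarrow> bool" where
  "psd X \<longleftrightarrow> transpose X = X \<and> (\<forall>v. v \<bullet> (X *v v) \<ge> 0)"

definition psd_ge :: "real ^ 'n ^ 'n \<Rightarrow> real ^ 'n ^ 'n \<Rightarrow> bool"  (infix "\<succeq>" 50) where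
  "X \<succeq> Y \<longleftrightarrow> transpose X = X \<and> transpose Y = Y \<and> psd (X - Y)"

definition outer_prod :: "real ^ 'n \<Rightarrow> real ^ 'm \<Rightarrow> real ^ 'm ^ 'n" where
  "outer_prod u v = (\<chi> i j. u $ i * v $ j)"

definition generated_events :: "'a measure \<Rightarrow> ('a \<Rightarrow> 'b) \<Rightarrow> 'b measure \<Rightarrow> 'a set set" where
  "generated_events M X N = {X -` S \<inter> space M | S. S \<in> sets N}"

text \<open>Independence is stated through generated events because \<open>prob_space.indep_var\<close> requires
  both random variables to have the same value type. The tuple \<open>(x 1, \<dots>, x k)\<close> is regarded as a
  single random element of the product space, so \<open>w k\<close> is independent of the variables jointly.
  The integrability conditions are explicit because the Bochner integral of a non-integrable
  function is \<open>0\<close> by convention.\<close>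

definition noise_assumption ::
  "'a measure \<Rightarrow> real \<Rightarrow> (nat \<Rightarrow> 'a \<Rightarrow> real ^ 'n) \<Rightarrow> (nat \<Rightarrow> 'a \<Rightarrow> real ^ 'n) \<Rightarrow> bool"
where
  "noise_assumption M \<sigma> w x \<longleftrightarrow> (\<forall>k.
     w k \<in> borel_measurable M \<and>
     integrable M (w k) \<and> integral\<^sup>L M (w k) = 0 \<and>
     prob_space.indep_set M
       (generated_events M (w k) borel)
       (generated_events M (\<lambda>\<omega>. \<lambda>i\<in>{1..k}. x i \<omega>) (\<Pi>\<^sub>M i\<in>{1..k}. borel)) \<and>
     integrable M (\<lambda>\<omega>. outer_prod (w k \<omega>) (w k \<omega>)) \<and>
     integral\<^sup>L M (\<lambda>\<omega>. outer_prod (w k \<omega>) (w k \<omega>)) = \<sigma>\<^sup>2 *\<^sub>R mat 1)"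

end

(*
  At the minimizer the gradient vanishes, and interpolating f - (mu/2)|.|^2, which is convex and
  (L - mu)-smooth, between x and xstar gives the sector bound
  (mu + L) <z, u> >= mu L |z|^2 + |u|^2 with z = x - xstar and u = grad f x. Evaluating the matrix
  inequality at the stacked vector (z, u) turns this into the contraction
  |z - alpha u| <= rho |z| of the noiseless step. The noise is centred and independent of the
  current iterate, so the cross term has zero mean and the expected squared error e k satisfies
  e (k + 1) <= rho^2 e k + alpha^2 sigma^2 d.
*)

theory Submission
  imports Defs
begin

section \<open>First-order inequalities for functions in \<open>S_class\<close>\<close>

lemma S_class_upper:
  assumes "f \<in> S_class \<mu> L"
  shows "f x - f y - grad f y \<bullet> (x - y) \<le> L / 2 * (norm (x - y))\<^sup>2"
  using assms by (simp add: S_class_def)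

lemma S_class_lower:
  assumes "f \<in> S_class \<mu> L"
  shows "\<mu> / 2 * (norm (x - y))\<^sup>2 \<le> f x - f y - grad f y \<bullet> (x - y)"
  using assms by (simp add: S_class_def)

text \<open>A gradient step of length 1/L from \<open>xs\<close> would lower f by at least |g|^2 /
  (2 L), where g is the gradient at \<open>xs\<close>; minimality leaves only g = 0.\<close>

lemma S_class_grad_minimizer:
  fixes f :: "real ^ 'n \<Rightarrow> real"
  assumes f: "f \<in> S_class \<mu> L" and L: "0 < L" and min: "\<And>y. f xs \<le> f y"
  shows "grad f xs = 0"
proof -
  let ?g = "grad f xs"
  have "f (xs - (1 / L) *\<^sub>R ?g) - f xs - ?g \<bullet> (- (1 / L) *\<^sub>R ?g)
      \<le> L / 2 * (norm (- (1 / L) *\<^sub>R ?g))\<^sup>2"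
    using S_class_upper[OF f, of "xs - (1 / L) *\<^sub>R ?g" xs] by simp
  then have "?g \<bullet> ?g / L \<le> L / 2 * (1 / L)\<^sup>2 * (?g \<bullet> ?g)"
    using min[of "xs - (1 / L) *\<^sub>R ?g"] L unfolding power2_norm_eq_inner
    by (simp add: power2_eq_square)
  then have "?g \<bullet> ?g \<le> 0"
    using L by (simp add: power2_eq_square field_simps)
  then show ?thesis
    using inner_gt_zero_iff[of ?g] by linarith
qed

text \<open>The function phi = f - (\<mu>/2) |. - xs|^2 has gradient \<open>v\<close> at
  \<open>x\<close> and 0 at \<open>xs\<close>, and its first-order remainders lie between 0 and
  (m/2) times the squared distance. The claim is its cocoercivity <v, v> \<le> m <v, z>, rewritten
  in terms of \<open>u\<close>.\<close>

lemma S_class_sector: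
  fixes f :: "real ^ 'n \<Rightarrow> real"
  assumes f: "f \<in> S_class \<mu> L" and "\<mu> \<le> L" and g0: "grad f xs = 0"
  shows "\<mu> * L * (norm (x - xs))\<^sup>2 + (norm (grad f x))\<^sup>2 \<le> (\<mu> + L) * ((x - xs) \<bullet> grad f x)"
proof -
  define z u v where "z = x - xs" and "u = grad f x" and "v = u - \<mu> *\<^sub>R z"
  define m where "m = L - \<mu>"
  have m: "0 \<le> m" using assms by (simp add: m_def)
  have key: "2 * t * (v \<bullet> v) - m * t\<^sup>2 * (v \<bullet> v) \<le> v \<bullet> z" for t
  proof -
    \<comment> \<open>In terms of phi, \<open>a1\<close> and \<open>a2\<close> bound phi (x - t v)
      below from \<open>xs\<close> and above from \<open>x\<close>, while \<open>a3\<close> and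
      \<open>a4\<close> bound phi (xs + t v) below from \<open>x\<close> and above from
      \<open>xs\<close>. In the sum of all four, every value of f cancels.\<close>
    have a1: "\<mu> / 2 * (norm (z - t *\<^sub>R v))\<^sup>2 \<le> f (x - t *\<^sub>R v) - f xs"
      using S_class_lower[OF f, of "x - t *\<^sub>R v" xs] g0 by (simp add: z_def algebra_simps)
    have a2: "f (x - t *\<^sub>R v) - f x + t * (u \<bullet> v) \<le> L / 2 * t\<^sup>2 * (v \<bullet> v)"
      using S_class_upper[OF f, of "x - t *\<^sub>R v" x]
      unfolding power2_norm_eq_inner by (simp add: u_def power2_eq_square)
    have a3: "\<mu> / 2 * (norm (t *\<^sub>R v - z))\<^sup>2 \<le> f (xs + t *\<^sub>R v) - f x - u \<bullet> (t *\<^sub>R v - z)"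
      using S_class_lower[OF f, of "xs + t *\<^sub>R v" x] by (simp add: u_def z_def algebra_simps)
    have a4: "f (xs + t *\<^sub>R v) - f xs \<le> L / 2 * t\<^sup>2 * (v \<bullet> v)"
      using S_class_upper[OF f, of "xs + t *\<^sub>R v" xs] g0
      unfolding power2_norm_eq_inner by (simp add: power2_eq_square)
    have u: "u = v + \<mu> *\<^sub>R z" by (simp add: v_def)
    show ?thesis
      using a1 a2 a3 a4 unfolding u m_def power2_norm_eq_inner
      by (simp add: inner_diff_left inner_diff_right inner_add_left inner_commute[of z v]
          power2_eq_square algebra_simps)
  qed
  have "v \<bullet> v \<le> m * (v \<bullet> z)"
  proof (cases "m = 0")
    case True
    \<comment> \<open>For m = 0 the left side of \<open>key\<close> is linear in t, hence unbounded
      unless v = 0; the chosen t makes it exceed the right side by 1.\<close>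
    have "v \<bullet> v = 0"
    proof (rule ccontr)
      assume "v \<bullet> v \<noteq> 0"
      then have "0 < v \<bullet> v" by simp
      then show False
        using key[of "(v \<bullet> z + 1) / (2 * (v \<bullet> v))"] True
        by (simp add: field_simps del: inner_gt_zero_iff)
    qed
    then show ?thesis using True by simp
  next
    case False
    \<comment> \<open>The value t = 1/m maximizes 2 t - m t^2, with maximum 1/m.\<close>
    then show ?thesis
      using key[of "1 / m"] m by (simp add: field_simps power2_eq_square)
  qed
  \<comment> \<open>After expanding v = u - \<mu> z, the terms \<mu>^2 |z|^2 on the two sides
    cancel.\<close>
  then show ?thesis
    unfolding z_def[symmetric] u_def[symmetric]
    by (simp add: v_def m_def power2_norm_eq_inner inner_diff_left inner_diff_right
        inner_commute[of u z] algebra_simps)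
qed

section \<open>Quadratic forms of block matrices and the contraction\<close>

definition stack :: "real ^ 'n \<Rightarrow> real ^ 'm \<Rightarrow> real ^ ('n + 'm)" where
  "stack z u = (\<chi> i. case i of Inl a \<Rightarrow> z $ a | Inr b \<Rightarrow> u $ b)"

lemma sum_UNIV_Plus:
  fixes g :: "'n::finite + 'm::finite \<Rightarrow> 'c::comm_monoid_add"
  shows "sum g UNIV = (\<Sum>a\<in>UNIV. g (Inl a)) + (\<Sum>b\<in>UNIV. g (Inr b))"
  unfolding UNIV_Plus_UNIV[symmetric] by (subst sum.Plus) auto

lemma block_matrix_mult_stack:
  "block_matrix M11 M12 M21 M22 *v stack z u
    = stack (M11 *v z + M12 *v u) (M21 *v z + M22 *v u)"
  by (simp add: vec_eq_iff matrix_vector_mult_def block_matrix_def stack_def sum_UNIV_Plus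
      split: sum.split)

lemma inner_stack: "stack z u \<bullet> stack z' u' = z \<bullet> z' + u \<bullet> u'"
  by (simp add: inner_vec_def stack_def sum_UNIV_Plus)

lemma scaled_mat_mult_vec: "(c *\<^sub>R mat 1 :: real ^ 'n ^ 'n) *v z = c *\<^sub>R z"
  by (simp flip: scaleR_matrix_vector_assoc)

text \<open>Since A z + B u = z - \<alpha> u, the quadratic form of \<open>\<Phi>\<close> at
  \<open>stack z u\<close> is p (|z - \<alpha> u|^2 - \<rho>^2 |z|^2). The other matrix gives twice
  the difference of the two sides of \<open>sector\<close>, which is nonpositive, and p > 0 can be
  divided out.\<close>

lemma matrix_inequality_contraction:
  fixes z u :: "real ^ 'n"
  assumes lmi: "block_matrix
           ((2 * \<mu> * L) *\<^sub>R mat 1) (- (\<mu> + L) *\<^sub>R mat 1)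
           (- (\<mu> + L) *\<^sub>R mat 1)   (2 *\<^sub>R mat 1)
         \<succeq> \<Phi> (mat 1) (- \<alpha> *\<^sub>R mat 1) (p *\<^sub>R mat 1 :: real ^ 'n ^ 'n) \<rho>"
    and "0 < p"
    and sector: "\<mu> * L * (norm z)\<^sup>2 + (norm u)\<^sup>2 \<le> (\<mu> + L) * (z \<bullet> u)"
  shows "(norm (z - \<alpha> *\<^sub>R u))\<^sup>2 \<le> \<rho>\<^sup>2 * (norm z)\<^sup>2"
proof -
  let ?X = "block_matrix
           ((2 * \<mu> * L) *\<^sub>R mat 1) (- (\<mu> + L) *\<^sub>R mat 1)
           (- (\<mu> + L) *\<^sub>R mat 1)   (2 *\<^sub>R mat 1 :: real ^ 'n ^ 'n)"
  let ?Y = "\<Phi> (mat 1) (- \<alpha> *\<^sub>R mat 1) (p *\<^sub>R mat 1 :: real ^ 'n ^ 'n) \<rho>"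
  have t: "transpose (c *\<^sub>R mat 1 :: real ^ 'n ^ 'n) = c *\<^sub>R mat 1" for c
    by (simp add: transpose_def mat_def vec_eq_iff eq_commute)
  have mm: "(c *\<^sub>R mat 1 :: real ^ 'n ^ 'n) ** (d *\<^sub>R mat 1) = (c * d) *\<^sub>R mat 1" for c d
    by (simp add: matrix_scalar_ac flip: scalar_matrix_assoc)
  have Y: "?Y = block_matrix
     ((p - \<rho>\<^sup>2 * p) *\<^sub>R mat 1) ((- p * \<alpha>) *\<^sub>R mat 1)
     ((- p * \<alpha>) *\<^sub>R mat 1) ((p * \<alpha>\<^sup>2) *\<^sub>R mat 1)"
    unfolding \<Phi>_def t transpose_mat mm matrix_mul_lid matrix_mul_rid
    by (simp add: algebra_simps power2_eq_square)
  have "0 \<le> stack z u \<bullet> ((?X - ?Y) *v stack z u)"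
    using lmi unfolding psd_ge_def psd_def by blast
  also have "\<dots> = stack z u \<bullet> (?X *v stack z u) - stack z u \<bullet> (?Y *v stack z u)"
    by (simp add: matrix_vector_mult_diff_rdistrib inner_diff_right)
  also have "stack z u \<bullet> (?X *v stack z u)
      = 2 * (\<mu> * L * (norm z)\<^sup>2 + (norm u)\<^sup>2 - (\<mu> + L) * (z \<bullet> u))"
    unfolding block_matrix_mult_stack inner_stack scaled_mat_mult_vec
    by (simp add: inner_add_right power2_norm_eq_inner inner_commute[of u z] algebra_simps)
  also have "stack z u \<bullet> (?Y *v stack z u) = p * ((norm (z - \<alpha> *\<^sub>R u))\<^sup>2 - \<rho>\<^sup>2 * (norm z)\<^sup>2)"
    unfolding Y block_matrix_mult_stack inner_stack scaled_mat_mult_vec power2_norm_eq_inner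
    by (simp add: inner_add_right inner_diff_left inner_diff_right inner_commute[of u z]
        power2_eq_square algebra_simps)
  finally have "p * ((norm (z - \<alpha> *\<^sub>R u))\<^sup>2 - \<rho>\<^sup>2 * (norm z)\<^sup>2)
      \<le> 2 * (\<mu> * L * (norm z)\<^sup>2 + (norm u)\<^sup>2 - (\<mu> + L) * (z \<bullet> u))"
    by simp
  also have "\<dots> \<le> 0"
    using sector by simp
  finally have "p * ((norm (z - \<alpha> *\<^sub>R u))\<^sup>2 - \<rho>\<^sup>2 * (norm z)\<^sup>2) \<le> 0" .
  then show ?thesis
    using \<open>0 < p\<close> by (simp add: mult_le_0_iff)
qed

section \<open>Independence, products and second moments\<close>

lemma sigma_sets_vimage_comp_subset:
  assumes Z: "Z \<in> measurable M N" and q: "q \<in> measurable N K"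
  shows "sigma_sets (space M) {(\<lambda>\<omega>. q (Z \<omega>)) -` S \<inter> space M |S. S \<in> sets K}
      \<subseteq> generated_events M Z N"
proof -
  have "(\<lambda>\<omega>. q (Z \<omega>)) \<in> space M \<rightarrow> space K"
    using Z q by (auto dest: measurable_space)
  \<comment> \<open>Preimages of a sigma-algebra already form one, so \<open>sigma_sets\<close> adds
    nothing, and each preimage under the composition is a preimage under \<open>Z\<close>.\<close>
  from sets_vimage_algebra2[OF this]
  have eq: "sigma_sets (space M) {(\<lambda>\<omega>. q (Z \<omega>)) -` S \<inter> space M |S. S \<in> sets K}
      = {(\<lambda>\<omega>. q (Z \<omega>)) -` S \<inter> space M |S. S \<in> sets K}"
    by (simp add: sets_vimage_algebra)
  show ?thesis
    unfolding eq generated_events_def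
  proof safe
    fix S assume "S \<in> sets K"
    moreover have "(\<lambda>\<omega>. q (Z \<omega>)) -` S \<inter> space M = Z -` (q -` S \<inter> space N) \<inter> space M"
      using Z by (auto dest: measurable_space)
    ultimately show "\<exists>T. (\<lambda>\<omega>. q (Z \<omega>)) -` S \<inter> space M = Z -` T \<inter> space M \<and> T \<in> sets N"
      using q by (blast intro: measurable_sets)
  qed
qed

text \<open>Independence of two families of events passes to subfamilies. \<open>W\<close> and
  \<open>X\<close> may take values in different types; only after applying \<open>g\<close> and
  \<open>h\<close> is the common type of \<open>indep_var\<close> reached.\<close>

lemma (in prob_space) indep_var_of_indep_generated_events:
  assumes ind: "indep_set (generated_events M W N1) (generated_events M X N2)"
    and W: "W \<in> measurable M N1" and X: "X \<in> measurable M N2"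
    and g: "g \<in> measurable N1 K1" and h: "h \<in> measurable N2 K2"
  shows "indep_var K1 (\<lambda>\<omega>. g (W \<omega>)) K2 (\<lambda>\<omega>. h (X \<omega>))"
  unfolding indep_var_eq
proof (intro conjI)
  show "random_variable K1 (\<lambda>\<omega>. g (W \<omega>))" "random_variable K2 (\<lambda>\<omega>. h (X \<omega>))"
    using W X g h by measurable
  show "indep_set
     (sigma_sets (space M) {(\<lambda>\<omega>. g (W \<omega>)) -` A \<inter> space M |A. A \<in> sets K1})
     (sigma_sets (space M) {(\<lambda>\<omega>. h (X \<omega>)) -` A \<inter> space M |A. A \<in> sets K2})"
    using ind sigma_sets_vimage_comp_subset[OF W g] sigma_sets_vimage_comp_subset[OF X h]
    unfolding indep_sets2_eq by blast
qed

text \<open>The product rule for independent real variables applies to each coordinate along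
  \<open>Basis\<close>, and it also yields integrability of each product. Summing the coordinates
  recovers the inner product.\<close>

lemma (in prob_space) expectation_inner_indep:
  fixes W :: "'a \<Rightarrow> 'b::euclidean_space" and h :: "'c \<Rightarrow> 'b"
  assumes ind: "indep_set (generated_events M W borel) (generated_events M X N)"
    and X: "X \<in> measurable M N" and h: "h \<in> borel_measurable N"
    and W: "integrable M W" and hX: "integrable M (\<lambda>\<omega>. h (X \<omega>))"
  shows "integrable M (\<lambda>\<omega>. h (X \<omega>) \<bullet> W \<omega>)"
    and "expectation (\<lambda>\<omega>. h (X \<omega>) \<bullet> W \<omega>) = expectation (\<lambda>\<omega>. h (X \<omega>)) \<bullet> expectation W"
proof -
  have Wm: "W \<in> borel_measurable M" using W by simp
  have iv: "indep_var borel (\<lambda>\<omega>. W \<omega> \<bullet> b) borel (\<lambda>\<omega>. h (X \<omega>) \<bullet> b)" for b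
    by (rule indep_var_of_indep_generated_events[OF ind Wm X, where h = "\<lambda>t. h t \<bullet> b"])
      (use h in measurable)
  have I: "integrable M (\<lambda>\<omega>. W \<omega> \<bullet> b)" "integrable M (\<lambda>\<omega>. h (X \<omega>) \<bullet> b)" for b
    using W hX by auto
  have prod: "integrable M (\<lambda>\<omega>. (h (X \<omega>) \<bullet> b) * (W \<omega> \<bullet> b))"
    "expectation (\<lambda>\<omega>. (h (X \<omega>) \<bullet> b) * (W \<omega> \<bullet> b))
      = (expectation (\<lambda>\<omega>. h (X \<omega>)) \<bullet> b) * (expectation W \<bullet> b)" for b
    using indep_var_integrable[OF iv I, of b] indep_var_lebesgue_integral[OF iv I, of b] W hX
    by (simp_all add: mult.commute)
  show "integrable M (\<lambda>\<omega>. h (X \<omega>) \<bullet> W \<omega>)"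
    by (subst euclidean_inner) (intro Bochner_Integration.integrable_sum prod)
  have "expectation (\<lambda>\<omega>. h (X \<omega>) \<bullet> W \<omega>)
      = (\<Sum>b\<in>Basis. expectation (\<lambda>\<omega>. (h (X \<omega>) \<bullet> b) * (W \<omega> \<bullet> b)))"
    by (subst euclidean_inner) (intro Bochner_Integration.integral_sum prod)
  also have "\<dots> = expectation (\<lambda>\<omega>. h (X \<omega>)) \<bullet> expectation W"
    by (subst (3) euclidean_inner) (simp add: prod)
  finally show "expectation (\<lambda>\<omega>. h (X \<omega>) \<bullet> W \<omega>) = \<dots>" .
qed

text \<open>The squared norm of w is the trace of its outer product with itself, and the trace is
  bounded linear, so it commutes with the integral. The dimension enters as the trace of the
  identity.\<close>

lemma outer_prod_second_moment:
  fixes W :: "'a \<Rightarrow> real ^ 'n"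
  assumes i: "integrable M (\<lambda>\<omega>. outer_prod (W \<omega>) (W \<omega>))"
    and e: "integral\<^sup>L M (\<lambda>\<omega>. outer_prod (W \<omega>) (W \<omega>)) = c *\<^sub>R mat 1"
  shows "integrable M (\<lambda>\<omega>. (norm (W \<omega>))\<^sup>2)"
    and "integral\<^sup>L M (\<lambda>\<omega>. (norm (W \<omega>))\<^sup>2) = c * real CARD('n)"
proof -
  have "linear (trace :: real ^ 'n ^ 'n \<Rightarrow> real)"
    by (intro linearI) (simp_all add: trace_def sum.distrib sum_distrib_left)
  then have bl: "bounded_linear (trace :: real ^ 'n ^ 'n \<Rightarrow> real)"
    by (simp add: linear_conv_bounded_linear)
  have tr: "(norm w)\<^sup>2 = trace (outer_prod w w)" for w :: "real ^ 'n"
    by (simp add: power2_norm_eq_inner inner_vec_def trace_def outer_prod_def)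
  show "integrable M (\<lambda>\<omega>. (norm (W \<omega>))\<^sup>2)"
    unfolding tr by (rule integrable_bounded_linear[OF bl i])
  have "integral\<^sup>L M (\<lambda>\<omega>. (norm (W \<omega>))\<^sup>2) = trace (c *\<^sub>R mat 1 :: real ^ 'n ^ 'n)"
    unfolding tr integral_bounded_linear[OF bl i] e ..
  also have "\<dots> = c * real CARD('n)"
    by (simp add: trace_def mat_def)
  finally show "integral\<^sup>L M (\<lambda>\<omega>. (norm (W \<omega>))\<^sup>2) = c * real CARD('n)" .
qed

lemma (in prob_space) integrable_of_integrable_norm_power2:
  fixes Z :: "'a \<Rightarrow> 'b::{banach, second_countable_topology}"
  assumes "Z \<in> borel_measurable M" and "integrable M (\<lambda>\<omega>. (norm (Z \<omega>))\<^sup>2)"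
  shows "integrable M Z"
proof -
  have "integrable M (\<lambda>\<omega>. norm (Z \<omega>))"
    by (rule square_integrable_imp_integrable) (use assms in auto)
  then show ?thesis
    using assms(1) by (simp add: integrable_norm_iff)
qed

section \<open>The recursion for the expected squared error\<close>

theorem proposition4p3:
  fixes f :: "real ^ 'n \<Rightarrow> real"
    and xstar x0 :: "real ^ 'n"
    and M :: "'a measure"
    and x w :: "nat \<Rightarrow> 'a \<Rightarrow> real ^ 'n"
    and \<mu> L \<alpha> \<sigma> \<rho> p :: real
    and A B P :: "real ^ 'n ^ 'n"
  assumes "0 < \<mu>" and "\<mu> \<le> L"
    and "f \<in> S_class \<mu> L"
    and "\<forall>y. f xstar \<le> f y"
    and "0 < \<alpha>"
    and "prob_space M"
    and "\<forall>\<omega>\<in>space M. x 0 \<omega> = x0"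
    and "\<forall>k. \<forall>\<omega>\<in>space M. x (Suc k) \<omega> = x k \<omega> - \<alpha> *\<^sub>R (grad f (x k \<omega>) + w k \<omega>)"
    and "0 < \<sigma>"
    and "noise_assumption M \<sigma> w x"
    and "0 < \<rho>" and "\<rho> < 1" and "0 < p"
    and "A = mat 1" and "B = - \<alpha> *\<^sub>R mat 1" and "P = p *\<^sub>R mat 1"
    and "block_matrix
           ((2 * \<mu> * L) *\<^sub>R mat 1) (- (\<mu> + L) *\<^sub>R mat 1)
           (- (\<mu> + L) *\<^sub>R mat 1)   (2 *\<^sub>R mat 1)
         \<succeq> \<Phi> A B P \<rho>"
  shows "\<forall>k.
    integrable M (\<lambda>\<omega>. (norm (x k \<omega> - xstar))\<^sup>2) \<and>
    integral\<^sup>L M (\<lambda>\<omega>. (norm (x k \<omega> - xstar))\<^sup>2)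
      \<le> \<rho> ^ (2 * k) * (norm (x0 - xstar))\<^sup>2
        + (1 - \<rho> ^ (2 * k)) / (1 - \<rho>\<^sup>2) * \<sigma>\<^sup>2 * \<alpha>\<^sup>2 * real CARD('n)"
proof -
  interpret prob_space M by fact
  note f = \<open>f \<in> S_class \<mu> L\<close>
  have noise: "w k \<in> borel_measurable M" "integrable M (w k)" "expectation (w k) = 0"
    "indep_set (generated_events M (w k) borel)
       (generated_events M (\<lambda>\<omega>. \<lambda>i\<in>{1..k}. x i \<omega>) (\<Pi>\<^sub>M i\<in>{1..k}. borel))"
    "integrable M (\<lambda>\<omega>. outer_prod (w k \<omega>) (w k \<omega>))"
    "expectation (\<lambda>\<omega>. outer_prod (w k \<omega>) (w k \<omega>)) = \<sigma>\<^sup>2 *\<^sub>R mat 1" for k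
    using \<open>noise_assumption M \<sigma> w x\<close> unfolding noise_assumption_def by blast+
  note w2 = outer_prod_second_moment[OF noise(5,6)]
  have init: "x 0 \<omega> = x0" if "\<omega> \<in> space M" for \<omega>
    using assms(7) that by blast
  have step: "x (Suc k) \<omega> = x k \<omega> - \<alpha> *\<^sub>R (grad f (x k \<omega>) + w k \<omega>)" if "\<omega> \<in> space M" for k \<omega>
    using assms(8) that by blast
  have grad_m [measurable]: "grad f \<in> borel_measurable borel"
    using f by (intro borel_measurable_continuous_onI) (simp add: S_class_def)
  have x_m [measurable]: "x k \<in> borel_measurable M" for k
  proof (induction k)
    case 0
    \<comment> \<open>The iterates are prescribed only on \<open>space M\<close>, so facts about
      them are transferred by congruence rules, here and below.\<close>
    show ?case by (subst measurable_cong[OF init]) simp_all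
  next
    case (Suc k)
    note [measurable] = Suc noise(1)
    show ?case by (subst measurable_cong[OF step]) (assumption, measurable)
  qed
  \<comment> \<open>\<open>G y\<close> is the error after a noiseless step from \<open>y\<close>, so
    the next error of the iteration is G (x k) - \<alpha> w k.\<close>
  define G where "G y = y - xstar - \<alpha> *\<^sub>R grad f y" for y
  have G_m [measurable]: "G \<in> borel_measurable borel"
    unfolding G_def by measurable
  have g0: "grad f xstar = 0"
    by (rule S_class_grad_minimizer[OF f]) (use assms(1,2,4) in auto)
  have contraction: "(norm (G y))\<^sup>2 \<le> \<rho>\<^sup>2 * (norm (y - xstar))\<^sup>2" for y
    unfolding G_def
    by (rule matrix_inequality_contraction[OF _ \<open>0 < p\<close> S_class_sector[OF f \<open>\<mu> \<le> L\<close> g0]])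
      (use assms(14-17) in simp)
  let ?c = "\<sigma>\<^sup>2 * \<alpha>\<^sup>2 * real CARD('n)"
  let ?e = "\<lambda>k. expectation (\<lambda>\<omega>. (norm (x k \<omega> - xstar))\<^sup>2)"
  have recursion: "integrable M (\<lambda>\<omega>. (norm (x (Suc k) \<omega> - xstar))\<^sup>2) \<and> ?e (Suc k) \<le> \<rho>\<^sup>2 * ?e k + ?c"
    if int: "integrable M (\<lambda>\<omega>. (norm (x k \<omega> - xstar))\<^sup>2)" for k
  proof -
    have G2: "integrable M (\<lambda>\<omega>. (norm (G (x k \<omega>)))\<^sup>2)"
      by (rule Bochner_Integration.integrable_bound[OF integrable_mult_right[OF int, of "\<rho>\<^sup>2"]])
        (use contraction in \<open>auto simp: abs_mult\<close>)
    \<comment> \<open>Factoring the expectation of the cross term requires a finite mean of G (x k),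
      which the second moment provides on a probability space.\<close>
    have G1: "integrable M (\<lambda>\<omega>. G (x k \<omega>))"
      by (rule integrable_of_integrable_norm_power2[OF _ G2]) measurable
    \<comment> \<open>The tuple in the noise assumption starts at index 1, so \<open>x 0\<close> enters as a constant.\<close>
    define h where "h t = G (if k = 0 then x0 else t k)" for t :: "nat \<Rightarrow> real ^ 'n"
    let ?X = "\<lambda>\<omega>. \<lambda>i\<in>{1..k}. x i \<omega>"
    have hX: "h (?X \<omega>) = G (x k \<omega>)" if "\<omega> \<in> space M" for \<omega>
      using init[OF that] by (auto simp: h_def)
    have h_m: "h \<in> borel_measurable (\<Pi>\<^sub>M i\<in>{1..k}. borel)"
      unfolding h_def by (cases "k = 0") simp_all
    have X_m: "?X \<in> measurable M (\<Pi>\<^sub>M i\<in>{1..k}. borel)"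
      by measurable
    have hX_int: "integrable M (\<lambda>\<omega>. h (?X \<omega>))"
      by (subst Bochner_Integration.integrable_cong[OF refl hX]) (simp_all add: G1)
    note cross_product = expectation_inner_indep[where h = h and X = ?X and W = "w k",
      OF noise(4)[of k] X_m h_m noise(2)[of k] hX_int]
    have eq: "h (?X \<omega>) \<bullet> w k \<omega> = G (x k \<omega>) \<bullet> w k \<omega>" if "\<omega> \<in> space M" for \<omega>
      using hX[OF that] by simp
    have cross_int: "integrable M (\<lambda>\<omega>. G (x k \<omega>) \<bullet> w k \<omega>)"
      using cross_product(1) iffD1[OF Bochner_Integration.integrable_cong[OF refl eq, of M]]
      by simp
    \<comment> \<open>The expectation factors, and the factor from the noise is 0; the mean of G (x
      k) itself may be nonzero.\<close>
    have cross: "expectation (\<lambda>\<omega>. G (x k \<omega>) \<bullet> w k \<omega>) = 0"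
      using cross_product(2) Bochner_Integration.integral_cong[OF refl eq, of M]
      by (simp add: noise(3))
    have expand: "(norm (x (Suc k) \<omega> - xstar))\<^sup>2
        = (norm (G (x k \<omega>)))\<^sup>2 - 2 * \<alpha> * (G (x k \<omega>) \<bullet> w k \<omega>) + \<alpha>\<^sup>2 * (norm (w k \<omega>))\<^sup>2"
      if "\<omega> \<in> space M" for \<omega>
    proof -
      have eq: "x (Suc k) \<omega> - xstar = G (x k \<omega>) - \<alpha> *\<^sub>R w k \<omega>"
        using step[OF that] by (simp add: G_def algebra_simps)
      show ?thesis
        unfolding eq power2_norm_eq_inner
        by (simp add: inner_diff_left inner_diff_right inner_commute[of "w k \<omega>" "G (x k \<omega>)"]
            power2_eq_square algebra_simps)
    qed
    have i: "integrable M (\<lambda>\<omega>. (norm (x (Suc k) \<omega> - xstar))\<^sup>2)"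
      by (subst Bochner_Integration.integrable_cong[OF refl expand])
        (assumption, intro Bochner_Integration.integrable_add Bochner_Integration.integrable_diff
          integrable_mult_right G2 cross_int w2(1))
    have "?e (Suc k) = expectation (\<lambda>\<omega>. (norm (G (x k \<omega>)))\<^sup>2
        - 2 * \<alpha> * (G (x k \<omega>) \<bullet> w k \<omega>) + \<alpha>\<^sup>2 * (norm (w k \<omega>))\<^sup>2)"
      by (rule Bochner_Integration.integral_cong[OF refl expand])
    also have "\<dots> = expectation (\<lambda>\<omega>. (norm (G (x k \<omega>)))\<^sup>2) + ?c"
      by (simp add: G2 cross_int w2 cross)
    also have "expectation (\<lambda>\<omega>. (norm (G (x k \<omega>)))\<^sup>2)
        \<le> expectation (\<lambda>\<omega>. \<rho>\<^sup>2 * (norm (x k \<omega> - xstar))\<^sup>2)"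
      by (intro integral_mono G2 integrable_mult_right int contraction)
    finally show ?thesis
      using i by simp
  qed
  have \<rho>2: "\<rho>\<^sup>2 < 1"
    using \<open>0 < \<rho>\<close> \<open>\<rho> < 1\<close> by (simp add: power_less_one_iff)
  show ?thesis
  proof
    fix k
    show "integrable M (\<lambda>\<omega>. (norm (x k \<omega> - xstar))\<^sup>2) \<and>
      ?e k \<le> \<rho> ^ (2 * k) * (norm (x0 - xstar))\<^sup>2
        + (1 - \<rho> ^ (2 * k)) / (1 - \<rho>\<^sup>2) * \<sigma>\<^sup>2 * \<alpha>\<^sup>2 * real CARD('n)"
    \<comment> \<open>Integrability is part of the induction because \<open>recursion\<close> takes
      it as a premise. It also rules out that the bound holds merely through the default value 0 of
      the integral.\<close>
    proof (induction k)
      case 0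
      have eq: "(norm (x 0 \<omega> - xstar))\<^sup>2 = (norm (x0 - xstar))\<^sup>2" if "\<omega> \<in> space M" for \<omega>
        using init[OF that] by simp
      have "integrable M (\<lambda>\<omega>. (norm (x 0 \<omega> - xstar))\<^sup>2)"
        by (subst Bochner_Integration.integrable_cong[OF refl eq]) simp_all
      moreover have "?e 0 = (norm (x0 - xstar))\<^sup>2"
        by (subst Bochner_Integration.integral_cong[OF refl eq]) (simp_all add: prob_space)
      ultimately show ?case by simp
    next
      case (Suc k)
      have "?e (Suc k) \<le> \<rho>\<^sup>2 * ?e k + ?c"
        using recursion Suc by blast
      also have "\<dots> \<le> \<rho>\<^sup>2 * (\<rho> ^ (2 * k) * (norm (x0 - xstar))\<^sup>2
          + (1 - \<rho> ^ (2 * k)) / (1 - \<rho>\<^sup>2) * ?c) + ?c"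
        using Suc by (intro add_right_mono mult_left_mono) (simp_all add: mult.assoc)
      also have "\<dots> = \<rho> ^ (2 * Suc k) * (norm (x0 - xstar))\<^sup>2
          + (\<rho>\<^sup>2 * (1 - \<rho> ^ (2 * k)) / (1 - \<rho>\<^sup>2) + 1) * ?c"
        by (simp add: power2_eq_square algebra_simps)
      \<comment> \<open>The quotient is the geometric sum of \<rho>^(2 j) over j < k; multiplying by
        \<rho>^2 and adding 1 appends one term. The denominator is nonzero by
        \<open>\<rho>2\<close>.\<close>
      also have "\<rho>\<^sup>2 * (1 - \<rho> ^ (2 * k)) / (1 - \<rho>\<^sup>2) + 1 = (1 - \<rho> ^ (2 * Suc k)) / (1 - \<rho>\<^sup>2)"
        using \<rho>2 by (simp add: field_simps power2_eq_square)
      finally show ?case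
        using recursion Suc by (simp add: mult.assoc)
    qed
  qed
qed

end
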